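(* Let $\mathfrak k$ be any positively graded nilpotent Lie algebra. Then there is a $(2,3)$-trivial Lie algebra whose derived algebra is $\mathfrak k$.
   Context: Lie algebras are real and finite-dimensional. A nilpotent Lie algebra $\mathfrak k$ is positively graded if there is a vector space direct sum decomposition $\mathfrak k=\mathfrak k_1+\dots+\mathfrak k_r$ with $[\mathfrak k_i,\mathfrak k_j]\subset\mathfrak k_{i+j}$ for all $i,j$ (with $\mathfrak k_s=\{0\}$ for $s>r$). A Lie algebra $\mathfrak g$ is $(2,3)$-trivial if $b_2(\mathfrak g)=0=b_3(\mathfrak g)$, where $b_n(\mathfrak g)=\dim H^n(\mathfrak g)$ for Lie algebra cohomology with trivial real coefficients. The derived algebra of $\mathfrak g$ is $[\mathfrak g,\mathfrak g]$. *)

theory Defs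
  imports "HOL-Analysis.Analysis" "HOL-Library.Function_Algebras"
begin

text \<open>
  Functions into a real vector space form a real vector space under the pointwise operations.
  This is used for cochains and for \<^typ>\<open>nat \<Rightarrow> real\<close>, which contains a copy of every
  finite-dimensional real vector space.
\<close>

instantiation "fun" :: (type, real_vector) real_vector
begin

definition scaleR_fun :: "real \<Rightarrow> ('a \<Rightarrow> 'b) \<Rightarrow> 'a \<Rightarrow> 'b" where
  "scaleR_fun c f = (\<lambda>x. c *\<^sub>R f x)"

instance
  by standard (auto simp: scaleR_fun_def plus_fun_def algebra_simps)

end

lemma scaleR_fun_apply [simp]: "(c *\<^sub>R f) x = c *\<^sub>R f x"
  by (simp add: scaleR_fun_def)


section \<open>Finite-dimensional real Lie algebras\<close>

text \<open>
  The underlying space is a subspace \<open>L\<close> of an ambient real vector space; the values of the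
  bracket outside \<open>L\<close> are irrelevant.
\<close>

locale lie_algebra =
  fixes L :: "'a::real_vector set" and br :: "'a \<Rightarrow> 'a \<Rightarrow> 'a"
  assumes subspace: "subspace L"
    and finite_dimensional: "\<exists>B. finite B \<and> L = span B"
    and closed: "\<lbrakk>x \<in> L; y \<in> L\<rbrakk> \<Longrightarrow> br x y \<in> L"
    and add_left: "\<lbrakk>x \<in> L; y \<in> L; z \<in> L\<rbrakk> \<Longrightarrow> br (x + y) z = br x z + br y z"
    and add_right: "\<lbrakk>x \<in> L; y \<in> L; z \<in> L\<rbrakk> \<Longrightarrow> br x (y + z) = br x y + br x z"
    and scale_left: "\<lbrakk>x \<in> L; y \<in> L\<rbrakk> \<Longrightarrow> br (c *\<^sub>R x) y = c *\<^sub>R br x y"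
    and scale_right: "\<lbrakk>x \<in> L; y \<in> L\<rbrakk> \<Longrightarrow> br x (c *\<^sub>R y) = c *\<^sub>R br x y"
    and alternating: "x \<in> L \<Longrightarrow> br x x = 0"
    and jacobi: "\<lbrakk>x \<in> L; y \<in> L; z \<in> L\<rbrakk> \<Longrightarrow> br x (br y z) + br y (br z x) + br z (br x y) = 0"

definition lie_isomorphic ::
  "'a::real_vector set \<Rightarrow> ('a \<Rightarrow> 'a \<Rightarrow> 'a) \<Rightarrow> 'b::real_vector set \<Rightarrow> ('b \<Rightarrow> 'b \<Rightarrow> 'b) \<Rightarrow> bool" where
  "lie_isomorphic L br L' br' \<longleftrightarrow>
     (\<exists>\<phi>. bij_betw \<phi> L L' \<and>
          (\<forall>x\<in>L. \<forall>y\<in>L. \<phi> (x + y) = \<phi> x + \<phi> y) \<and>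
          (\<forall>c. \<forall>x\<in>L. \<phi> (c *\<^sub>R x) = c *\<^sub>R \<phi> x) \<and>
          (\<forall>x\<in>L. \<forall>y\<in>L. \<phi> (br x y) = br' (\<phi> x) (\<phi> y)))"

definition bracket_span :: "('a::real_vector \<Rightarrow> 'a \<Rightarrow> 'a) \<Rightarrow> 'a set \<Rightarrow> 'a set \<Rightarrow> 'a set" where
  "bracket_span br A B = span {br x y | x y. x \<in> A \<and> y \<in> B}"

definition derived_algebra :: "'a::real_vector set \<Rightarrow> ('a \<Rightarrow> 'a \<Rightarrow> 'a) \<Rightarrow> 'a set" where
  "derived_algebra L br = bracket_span br L L"

primrec lower_central_series ::
  "'a::real_vector set \<Rightarrow> ('a \<Rightarrow> 'a \<Rightarrow> 'a) \<Rightarrow> nat \<Rightarrow> 'a set" where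
  "lower_central_series L br 0 = L"
| "lower_central_series L br (Suc n) = bracket_span br L (lower_central_series L br n)"

definition nilpotent_lie_algebra :: "'a::real_vector set \<Rightarrow> ('a \<Rightarrow> 'a \<Rightarrow> 'a) \<Rightarrow> bool" where
  "nilpotent_lie_algebra L br \<longleftrightarrow> lie_algebra L br \<and> (\<exists>n. lower_central_series L br n = {0})"

text \<open>
  The \<^const>\<open>bij_betw\<close> condition says that every element of \<open>L\<close> is, in exactly one way, a sum
  of elements of the \<open>V i\<close>, i.e. that \<open>L\<close> is the internal direct sum of \<open>V 1, \<dots>, V r\<close>.
\<close>

definition positively_graded :: "'a::real_vector set \<Rightarrow> ('a \<Rightarrow> 'a \<Rightarrow> 'a) \<Rightarrow> bool" where
  "positively_graded L br \<longleftrightarrow>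
     (\<exists>(r::nat) V.
        (\<forall>i\<in>{1..r}. subspace (V i)) \<and>
        (\<forall>s>r. V s = {0}) \<and>
        bij_betw (\<lambda>v. \<Sum>i\<in>{1..r}. v i) (\<Pi>\<^sub>E i\<in>{1..r}. V i) L \<and>
        (\<forall>i\<in>{1..r}. \<forall>j\<in>{1..r}. \<forall>x\<in>V i. \<forall>y\<in>V j. br x y \<in> V (i + j)))"


section \<open>Dimension of a quotient space\<close>

text \<open>
  \<open>S\<close> is a basis of \<open>V\<close> modulo \<open>W\<close> iff the cosets \<open>s + W\<close> for \<open>s \<in> S\<close> are pairwise
  distinct and form a basis of \<open>V / W\<close>; distinctness follows from the independence clause.
\<close>

definition basis_modulo :: "'a::real_vector set \<Rightarrow> 'a set \<Rightarrow> 'a set \<Rightarrow> bool" where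
  "basis_modulo V W S \<longleftrightarrow>
     finite S \<and> S \<subseteq> V \<and>
     (\<forall>c. (\<Sum>s\<in>S. c s *\<^sub>R s) \<in> W \<longrightarrow> (\<forall>s\<in>S. c s = 0)) \<and>
     (\<forall>v\<in>V. \<exists>c. v - (\<Sum>s\<in>S. c s *\<^sub>R s) \<in> W)"

text \<open>Meaningful only if \<open>V / W\<close> has finite dimension.\<close>

definition quotient_dim :: "'a::real_vector set \<Rightarrow> 'a set \<Rightarrow> nat" where
  "quotient_dim V W = card (SOME S. basis_modulo V W S)"

lemma basis_modulo_card:
  assumes V: "subspace V" and W: "subspace W" "W \<subseteq> V"
    and B: "finite B" "V \<subseteq> span B" and S: "basis_modulo V W S"
  shows "card S + dim W = dim V"
proof -
  obtain C where C: "C \<subseteq> W" "independent C" "W \<subseteq> span C"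
    by (rule maximal_independent_subset)
  have spanC: "span C = W"
    using C W(1) by (simp add: span_minimal subset_antisym)
  have finC: "finite C"
    using independent_span_bound[OF B(1) C(2)] C(1) W(2) B(2) by blast
  have finS: "finite S" and SV: "S \<subseteq> V"
    and ind: "\<And>c. (\<Sum>s\<in>S. c s *\<^sub>R s) \<in> W \<Longrightarrow> \<forall>s\<in>S. c s = 0"
    and sp: "\<And>v. v \<in> V \<Longrightarrow> \<exists>c. v - (\<Sum>s\<in>S. c s *\<^sub>R s) \<in> W"
    using S by (auto simp: basis_modulo_def)
  have disj: "S \<inter> C = {}"
  proof (rule ccontr)
    assume "S \<inter> C \<noteq> {}"
    then obtain t where t: "t \<in> S" "t \<in> C" by blast
    have "(\<Sum>s\<in>S. (if s = t then 1 else 0) *\<^sub>R s) = t"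
      using t finS by (simp add: if_distrib[of "\<lambda>c. c *\<^sub>R _"] cong: if_cong)
    then have "\<forall>s\<in>S. (if s = t then 1 else 0) = (0::real)"
      using t C(1) by (intro ind) auto
    with t(1) show False by auto
  qed
  have "independent (S \<union> C)"
  proof (rule independent_if_scalars_zero)
    fix f x assume eq: "(\<Sum>x\<in>S \<union> C. f x *\<^sub>R x) = 0" and x: "x \<in> S \<union> C"
    have split: "(\<Sum>x\<in>S. f x *\<^sub>R x) + (\<Sum>x\<in>C. f x *\<^sub>R x) = 0"
      using eq by (simp add: sum.union_disjoint finS finC disj)
    have "(\<Sum>x\<in>C. f x *\<^sub>R x) \<in> W"
      using spanC by (auto intro: span_sum span_scale span_base)
    then have "(\<Sum>x\<in>S. f x *\<^sub>R x) \<in> W"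
      using split subspace_neg[OF W(1)] by (metis eq_neg_iff_add_eq_0)
    then have fS: "\<forall>s\<in>S. f s = 0" by (rule ind)
    then have "(\<Sum>x\<in>C. f x *\<^sub>R x) = 0" using split by simp
    then have "\<forall>s\<in>C. f s = 0"
      using independentD[OF C(2) finC subset_refl, of f] by blast
    with fS x show "f x = 0" by blast
  qed (simp add: finS finC)
  moreover have "V \<subseteq> span (S \<union> C)"
  proof
    fix v assume "v \<in> V"
    then obtain c where c: "v - (\<Sum>s\<in>S. c s *\<^sub>R s) \<in> W" using sp by blast
    have "v - (\<Sum>s\<in>S. c s *\<^sub>R s) \<in> span (S \<union> C)"
      using c spanC span_mono[of C "S \<union> C"] by blast
    moreover have "(\<Sum>s\<in>S. c s *\<^sub>R s) \<in> span (S \<union> C)"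
      by (intro span_sum span_scale span_base) auto
    ultimately show "v \<in> span (S \<union> C)" by (metis diff_add_cancel span_add)
  qed
  ultimately have "dim V = card (S \<union> C)"
    using SV C(1) W(2) by (metis basis_card_eq_dim le_sup_iff order_trans)
  moreover have "dim W = card C" using C by (metis basis_card_eq_dim)
  ultimately show ?thesis by (simp add: card_Un_disjoint finS finC disj)
qed

lemma quotient_dim_eq:
  assumes V: "subspace V" and W: "subspace W" "W \<subseteq> V"
    and B: "finite B" "V \<subseteq> span B"
  shows "quotient_dim V W = dim V - dim W"
proof -
  obtain C where C: "C \<subseteq> W" "independent C" "W \<subseteq> span C"
    by (rule maximal_independent_subset)
  have spanC: "span C = W"
    using C W(1) by (simp add: span_minimal subset_antisym)
  obtain D where D: "C \<subseteq> D" "D \<subseteq> V" "independent D" "V \<subseteq> span D"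
    using maximal_independent_subset_extend[of C V] C W(2) by blast
  have finD: "finite D"
    using independent_span_bound[OF B(1) D(3)] D(2) B(2) by blast
  have "basis_modulo V W (D - C)"
    unfolding basis_modulo_def
  proof (intro conjI allI impI ballI)
    fix c s assume c: "(\<Sum>s\<in>D - C. c s *\<^sub>R s) \<in> W" and s: "s \<in> D - C"
    then obtain e where e: "(\<Sum>s\<in>D - C. c s *\<^sub>R s) = (\<Sum>s\<in>C. e s *\<^sub>R s)"
      using span_finite[of C] finite_subset[OF D(1) finD] spanC by auto
    have "(\<Sum>s\<in>D. (if s \<in> C then - e s else c s) *\<^sub>R s) = 0"
      using e by (simp add: sum.subset_diff[OF D(1) finD] sum_negf)
    then show "c s = 0"
      using independentD[OF D(3) finD subset_refl, of "\<lambda>s. if s \<in> C then - e s else c s" s] s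
      by auto
  next
    fix v assume "v \<in> V"
    then obtain e where e: "v = (\<Sum>s\<in>D. e s *\<^sub>R s)"
      using span_finite[OF finD] D(4) by auto
    have "v - (\<Sum>s\<in>D - C. e s *\<^sub>R s) = (\<Sum>s\<in>C. e s *\<^sub>R s)"
      by (simp add: e sum.subset_diff[OF D(1) finD])
    also have "\<dots> \<in> span C" by (intro span_sum span_scale span_base)
    finally show "\<exists>c. v - (\<Sum>s\<in>D - C. c s *\<^sub>R s) \<in> W" using spanC by blast
  qed (use D finD in auto)
  then have "basis_modulo V W (SOME S. basis_modulo V W S)" by (rule someI)
  from basis_modulo_card[OF V W B this] show ?thesis by (simp add: quotient_dim_def)
qed


section \<open>Lie algebra cohomology with trivial real coefficients\<close>

text \<open>
  An \<open>n\<close>-cochain, i.e. an alternating \<open>n\<close>-linear form on \<open>L\<close>, is encoded as a function on the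
  lists of length \<open>n\<close> over \<open>L\<close>, extended by \<open>0\<close> to all other lists so that equality of
  cochains is equality of functions.
\<close>

definition tuples :: "'a set \<Rightarrow> nat \<Rightarrow> 'a list set" where
  "tuples L n = {xs. length xs = n \<and> set xs \<subseteq> L}"

definition cochains :: "'a::real_vector set \<Rightarrow> nat \<Rightarrow> ('a list \<Rightarrow> real) set" where
  "cochains L n = {\<omega>.
     (\<forall>xs. xs \<notin> tuples L n \<longrightarrow> \<omega> xs = 0) \<and>
     (\<forall>xs\<in>tuples L n. \<forall>i<n. \<forall>x\<in>L. \<forall>y\<in>L. \<forall>a b.
        \<omega> (xs[i := a *\<^sub>R x + b *\<^sub>R y]) = a * \<omega> (xs[i := x]) + b * \<omega> (xs[i := y])) \<and>
     (\<forall>xs\<in>tuples L n. \<forall>i<n. \<forall>j<n. i \<noteq> j \<and> xs ! i = xs ! j \<longrightarrow> \<omega> xs = 0)}"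

text \<open>
  The Chevalley--Eilenberg differential from \<open>n\<close>-cochains to \<open>(n + 1)\<close>-cochains. The list
  \<open>nths xs (- {i, j})\<close> is \<open>xs\<close> with the entries at positions \<open>i\<close> and \<open>j\<close> omitted; positions
  are counted from \<open>0\<close>.
\<close>

definition ce_differential ::
  "'a::real_vector set \<Rightarrow> ('a \<Rightarrow> 'a \<Rightarrow> 'a) \<Rightarrow> nat \<Rightarrow> ('a list \<Rightarrow> real) \<Rightarrow> 'a list \<Rightarrow> real" where
  "ce_differential L br n \<omega> = (\<lambda>xs.
     if xs \<in> tuples L (Suc n)
     then \<Sum>j<Suc n. \<Sum>i<j. (-1) ^ (i + j) * \<omega> (br (xs ! i) (xs ! j) # nths xs (- {i, j}))
     else 0)"

definition cocycles ::
  "'a::real_vector set \<Rightarrow> ('a \<Rightarrow> 'a \<Rightarrow> 'a) \<Rightarrow> nat \<Rightarrow> ('a list \<Rightarrow> real) set" where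
  "cocycles L br n = {\<omega> \<in> cochains L n. ce_differential L br n \<omega> = 0}"

definition coboundaries ::
  "'a::real_vector set \<Rightarrow> ('a \<Rightarrow> 'a \<Rightarrow> 'a) \<Rightarrow> nat \<Rightarrow> ('a list \<Rightarrow> real) set" where
  "coboundaries L br n =
     (case n of 0 \<Rightarrow> {0} | Suc m \<Rightarrow> ce_differential L br m ` cochains L m)"

definition betti :: "'a::real_vector set \<Rightarrow> ('a \<Rightarrow> 'a \<Rightarrow> 'a) \<Rightarrow> nat \<Rightarrow> nat" where
  "betti L br n = quotient_dim (cocycles L br n) (coboundaries L br n)"

definition two_three_trivial :: "'a::real_vector set \<Rightarrow> ('a \<Rightarrow> 'a \<Rightarrow> 'a) \<Rightarrow> bool" where
  "two_three_trivial L br \<longleftrightarrow> betti L br 2 = 0 \<and> betti L br 3 = 0"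

end

theory Submission
  imports Defs
begin

text \<open>
  Let \<open>D\<close> be the derivation of \<open>k\<close> that multiplies \<open>k\<^sub>i\<close> by \<open>i\<close>, and let \<open>g = \<real>e + k\<close> with
  \<open>[e, x] = D x\<close>. As all weights are positive, \<open>D\<close> is onto and \<open>[g, g] = k\<close>. The contraction
  \<open>\<alpha> = \<omega>(e, \<dots>)\<close> of a cocycle \<open>\<omega>\<close> satisfies \<open>d\<alpha> = - w \<omega>\<close> on elements of \<open>k\<close> of total weight
  \<open>w\<close>. In degree at least 2 only positive weights occur, so one may divide \<open>\<alpha>\<close> by the weight of
  its arguments; the resulting form is a primitive of \<open>-\<omega>\<close>.
\<close>

section \<open>Maps linear on a subspace, and coordinates in
  \<open>nat \<Rightarrow> real\<close>\<close>

text \<open>Brackets and cochains are constrained only on their carrier, so linearity is asked only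
  for arguments in \<open>L\<close>.\<close>

definition linear_over :: "'a::real_vector set \<Rightarrow> ('a \<Rightarrow> 'b::real_vector) \<Rightarrow> bool" where
  "linear_over L F \<longleftrightarrow> (\<forall>x\<in>L. \<forall>y\<in>L. \<forall>a b. F (a *\<^sub>R x + b *\<^sub>R y) = a *\<^sub>R F x + b *\<^sub>R F y)"

lemma linear_overI:
  "(\<And>x y a b. \<lbrakk>x \<in> L; y \<in> L\<rbrakk> \<Longrightarrow> F (a *\<^sub>R x + b *\<^sub>R y) = a *\<^sub>R F x + b *\<^sub>R F y) \<Longrightarrow> linear_over L F"
  by (simp add: linear_over_def)

lemma linear_overD:
  "\<lbrakk>linear_over L F; x \<in> L; y \<in> L\<rbrakk> \<Longrightarrow> F (a *\<^sub>R x + b *\<^sub>R y) = a *\<^sub>R F x + b *\<^sub>R F y"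
  by (simp add: linear_over_def)

lemma linear_over_add: "\<lbrakk>linear_over L F; x \<in> L; y \<in> L\<rbrakk> \<Longrightarrow> F (x + y) = F x + F y"
  using linear_overD[of L F x y 1 1] by simp

lemma linear_over_scale: "\<lbrakk>linear_over L F; x \<in> L\<rbrakk> \<Longrightarrow> F (c *\<^sub>R x) = c *\<^sub>R F x"
  using linear_overD[of L F x x c 0] by simp

lemma linear_over_0: "\<lbrakk>linear_over L F; x \<in> L\<rbrakk> \<Longrightarrow> F 0 = 0"
  using linear_over_scale[of L F x 0] by simp

lemma linear_over_diff:
  "\<lbrakk>linear_over L F; linear_over L G\<rbrakk> \<Longrightarrow> linear_over L (\<lambda>x. F x - G x)"
  by (rule linear_overI) (simp add: linear_overD algebra_simps)

text \<open>The difference of the two maps vanishes on \<open>S\<close> and is compatible with the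
  linear combinations that build up \<open>span S\<close>.\<close>

lemma linear_over_eq_on_span:
  assumes "linear_over L F" "linear_over L G" "subspace L" "S \<subseteq> L"
    and eq: "\<And>x. x \<in> S \<Longrightarrow> F x = G x" and x: "x \<in> span S"
  shows "F x = G x"
proof -
  have span: "span S \<subseteq> L" using assms(3,4) by (simp add: span_minimal)
  have lin: "linear_over L (\<lambda>x. F x - G x)" using assms(1,2) by (rule linear_over_diff)
  \<comment> \<open>Membership in \<open>span S\<close> is part of the induction claim, since
    linearity is available only inside \<open>L\<close>.\<close>
  have "x \<in> span S \<and> F x - G x = 0" using x
  proof (induction rule: span_induct_alt)
    case base
    show ?case using linear_over_0[OF lin subspace_0[OF assms(3)]] span_zero by blast
  next
    case (step c x y)
    have "F (c *\<^sub>R x + 1 *\<^sub>R y) - G (c *\<^sub>R x + 1 *\<^sub>R y) = c *\<^sub>R (F x - G x) + 1 *\<^sub>R (F y - G y)"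
      using step span assms(4) by (intro linear_overD[OF lin]) auto
    with step eq show ?case by (auto intro: span_add span_scale span_base)
  qed
  then show ?thesis by simp
qed

text \<open>One inclusion holds because the image of a subspace is a subspace, the other by
  induction over \<open>span S\<close>. It yields finite spanning sets and derived algebras of
  images.\<close>

lemma linear_over_span_image:
  assumes \<phi>: "linear_over L \<phi>" and L: "subspace L" and S: "S \<subseteq> L"
  shows "span (\<phi> ` S) = \<phi> ` span S"
proof
  have span: "span S \<subseteq> L" using L S by (simp add: span_minimal)
  have zero: "\<phi> 0 = 0" using linear_over_0[OF \<phi> subspace_0[OF L]] .
  have "subspace (\<phi> ` span S)"
    unfolding subspace_def
  proof (intro conjI ballI allI)
    show "0 \<in> \<phi> ` span S" using zero span_zero by (metis image_eqI)
    show "u + v \<in> \<phi> ` span S" if "u \<in> \<phi> ` span S" "v \<in> \<phi> ` span S" for u v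
      using that span by (auto simp: linear_over_add[OF \<phi>, symmetric] subset_iff intro!: imageI span_add)
    show "c *\<^sub>R u \<in> \<phi> ` span S" if "u \<in> \<phi> ` span S" for c u
      using that span
      by (auto simp: linear_over_scale[OF \<phi>, symmetric] subset_iff intro!: imageI span_scale)
  qed
  then show "span (\<phi> ` S) \<subseteq> \<phi> ` span S"
    by (intro span_minimal image_mono span_superset)
  have "x \<in> span S \<and> \<phi> x \<in> span (\<phi> ` S)" if "x \<in> span S" for x
    using that
  proof (induction rule: span_induct_alt)
    case base
    show ?case by (simp add: zero span_zero)
  next
    case (step c x y)
    then have "\<phi> (c *\<^sub>R x + y) = c *\<^sub>R \<phi> x + \<phi> y"
      using linear_overD[OF \<phi>, of x y c 1] S span by auto
    with step show ?case by (auto intro: span_add span_scale span_base)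
  qed
  then show "\<phi> ` span S \<subseteq> span (\<phi> ` S)" by auto
qed

text \<open>Coordinates with respect to a finite basis, padded by zeros, place the space inside
  \<open>nat \<Rightarrow> real\<close>, the ambient space of the algebra to be constructed.\<close>

lemma finite_dimensional_embedding:
  fixes L :: "'a::real_vector set"
  assumes L: "L = span B" and B: "finite B"
  obtains \<phi> :: "'a \<Rightarrow> nat \<Rightarrow> real" where "linear_over L \<phi>" "inj_on \<phi> L"
proof -
  obtain C where C: "C \<subseteq> B" "independent C" "B \<subseteq> span C"
    by (rule maximal_independent_subset)
  have span: "L = span C"
    using C L by (metis span_mono span_span subset_antisym)
  have fin: "finite C" using C(1) B finite_subset by blast
  obtain f where f: "bij_betw f {0..<card C} C"
    using ex_bij_betw_nat_finite[OF fin] by blast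
  define \<phi> where "\<phi> x = (\<lambda>n. if n < card C then representation C x (f n) else 0)" for x
  have "linear_over L \<phi>"
    by (rule linear_overI)
      (auto simp: \<phi>_def fun_eq_iff span representation_add[OF C(2)] representation_scale[OF C(2)]
        span_scale)
  moreover have "inj_on \<phi> L"
  proof (rule inj_onI)
    fix x y assume xy: "x \<in> L" "y \<in> L" "\<phi> x = \<phi> y"
    have "representation C x b = representation C y b" if b: "b \<in> C" for b
    proof -
      obtain n where "n < card C" "f n = b"
        using f b unfolding bij_betw_def by (metis atLeastLessThan_iff imageE)
      with fun_cong[OF xy(3), of n] show ?thesis by (simp add: \<phi>_def)
    qed
    then have "(\<Sum>b\<in>C. representation C x b *\<^sub>R b) = (\<Sum>b\<in>C. representation C y b *\<^sub>R b)"
      by simp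
    then show "x = y"
      using sum_representation_eq[OF C(2) _ fin subset_refl] xy span by simp
  qed
  ultimately show ?thesis using that by blast
qed

section \<open>Vanishing quotients, cochains and the differential in low degree\<close>

text \<open>This makes the inclusion of cocycles in coboundaries suffice, without \<open>d \<circ> d = 0\<close>.\<close>

lemma quotient_dim_eq_0:
  assumes "V \<subseteq> W" "0 \<in> W"
  shows "quotient_dim V W = 0"
proof -
  have empty: "S = {}" if S: "basis_modulo V W S" for S
  proof (rule ccontr)
    assume "S \<noteq> {}"
    then obtain t where t: "t \<in> S" by blast
    have S': "finite S" "S \<subseteq> V"
      "\<And>c. (\<Sum>s\<in>S. c s *\<^sub>R s) \<in> W \<Longrightarrow> \<forall>s\<in>S. c s = 0"
      using S by (auto simp: basis_modulo_def)
    have "(\<Sum>s\<in>S. (if s = t then 1 else 0) *\<^sub>R s) = t"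
      using t S'(1) by (simp add: if_distrib[of "\<lambda>c. c *\<^sub>R _"] cong: if_cong)
    then have "\<forall>s\<in>S. (if s = t then 1 else 0) = (0::real)"
      using t S'(2) assms by (intro S'(3)) auto
    with t show False by auto
  qed
  have "basis_modulo V W {}" using assms by (auto simp: basis_modulo_def)
  then have "basis_modulo V W (SOME S. basis_modulo V W S)" by (rule someI)
  then have "(SOME S. basis_modulo V W S) = {}" by (rule empty)
  then show ?thesis by (simp add: quotient_dim_def)
qed

text \<open>Replaces list updates by a free slot between \<open>xs\<close> and \<open>ys\<close>, so
  that linearity in each argument of a concrete list is a direct instance.\<close>

lemma cochain_linear:
  assumes "\<omega> \<in> cochains L n" "set xs \<subseteq> L" "set ys \<subseteq> L" "length xs + Suc (length ys) = n"
  shows "linear_over L (\<lambda>x. \<omega> (xs @ x # ys))"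
proof (rule linear_overI)
  fix x y a b assume xy: "x \<in> L" "y \<in> L"
  let ?zs = "xs @ x # ys"
  have "\<forall>zs\<in>tuples L n. \<forall>i<n. \<forall>x\<in>L. \<forall>y\<in>L. \<forall>a b.
      \<omega> (zs[i := a *\<^sub>R x + b *\<^sub>R y]) = a * \<omega> (zs[i := x]) + b * \<omega> (zs[i := y])"
    using assms(1) by (simp add: cochains_def)
  moreover have "?zs \<in> tuples L n" "length xs < n"
    using assms(2-4) xy by (auto simp: tuples_def)
  ultimately have "\<omega> (?zs[length xs := a *\<^sub>R x + b *\<^sub>R y]) =
      a * \<omega> (?zs[length xs := x]) + b * \<omega> (?zs[length xs := y])"
    using xy by blast
  then show "\<omega> (xs @ (a *\<^sub>R x + b *\<^sub>R y) # ys) = a *\<^sub>R \<omega> (xs @ x # ys) + b *\<^sub>R \<omega> (xs @ y # ys)"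
    by simp
qed

text \<open>Expand \<open>f (x + y) (x + y) = 0\<close>. The form of the statement serves brackets,
  2-forms and two adjacent arguments of a 3-form alike.\<close>

lemma bilinear_alternating_antisym:
  assumes "\<And>x. x \<in> L \<Longrightarrow> linear_over L (f x)" "\<And>y. y \<in> L \<Longrightarrow> linear_over L (\<lambda>x. f x y)"
    and "\<And>x. x \<in> L \<Longrightarrow> f x x = 0" and "subspace L" "x \<in> L" "y \<in> L"
  shows "f x y = - f y x"
proof -
  have xy: "x + y \<in> L" using assms(4-6) by (simp add: subspace_add)
  have "0 = f (x + y) (x + y)" using assms(3) xy by simp
  also have "\<dots> = f x (x + y) + f y (x + y)"
    using linear_over_add[OF assms(2)[OF xy]] assms(5,6) by blast
  also have "\<dots> = f x x + f x y + (f y x + f y y)"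
    using assms(1)[of x] assms(1)[of y] assms(5,6) by (simp add: linear_over_add[of L])
  finally show ?thesis using assms(3,5,6) by (simp add: add_eq_0_iff)
qed

text \<open>Unrolling the double sum turns the cocycle conditions into identities between values of
  the form. Counting positions from 0 shifts \<open>i\<close> and \<open>j\<close> together, so the
  signs are the usual ones.\<close>

lemma ce_differential_1:
  "\<lbrakk>x \<in> L; y \<in> L\<rbrakk> \<Longrightarrow> ce_differential L br (Suc 0) \<omega> [x, y] = - \<omega> [br x y]"
  by (simp add: ce_differential_def tuples_def nths_Cons)

lemma ce_differential_2:
  "\<lbrakk>x \<in> L; y \<in> L; z \<in> L\<rbrakk> \<Longrightarrow> ce_differential L br 2 \<omega> [x, y, z] =
    - \<omega> [br x y, z] + \<omega> [br x z, y] - \<omega> [br y z, x]"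
  by (simp add: ce_differential_def tuples_def nths_Cons numeral_2_eq_2)

lemma ce_differential_3:
  "\<lbrakk>t \<in> L; x \<in> L; y \<in> L; z \<in> L\<rbrakk> \<Longrightarrow> ce_differential L br 3 \<omega> [t, x, y, z] =
    - \<omega> [br t x, y, z] + \<omega> [br t y, x, z] - \<omega> [br t z, x, y]
    - \<omega> [br x y, t, z] + \<omega> [br x z, t, y] - \<omega> [br y z, t, x]"
  by (simp add: ce_differential_def tuples_def nths_Cons numeral_3_eq_3)

section \<open>Bracket identities and transport of a Lie algebra\<close>

context lie_algebra
begin

lemma br_linear_right: "x \<in> L \<Longrightarrow> linear_over L (br x)"
  by (rule linear_overI) (simp add: add_right scale_right subspace subspace_scale)

lemma br_linear_left: "y \<in> L \<Longrightarrow> linear_over L (\<lambda>x. br x y)"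
  by (rule linear_overI) (simp add: add_left scale_left subspace subspace_scale)

lemma br_antisym: "\<lbrakk>x \<in> L; y \<in> L\<rbrakk> \<Longrightarrow> br x y = - br y x"
  by (rule bilinear_alternating_antisym[of L br])
    (auto simp: br_linear_left br_linear_right alternating subspace)

lemma br_0_right: "x \<in> L \<Longrightarrow> br x 0 = 0"
  using linear_over_0 br_linear_right by blast

lemma linear_combination_in_L: "x \<in> L \<Longrightarrow> y \<in> L \<Longrightarrow> a *\<^sub>R x + b *\<^sub>R y \<in> L"
  by (simp add: subspace subspace_add subspace_scale)

text \<open>Transport of structure: a linear combination of images is the image of the same
  combination in \<open>L\<close>, and \<open>\<psi>\<close> undoes \<open>\<phi>\<close> there, so
  each axiom pulls back to \<open>L\<close>.\<close>

lemma lie_algebra_image: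
  assumes \<phi>: "linear_over L \<phi>" and \<psi>: "\<And>x. x \<in> L \<Longrightarrow> \<psi> (\<phi> x) = x"
  shows "lie_algebra (\<phi> ` L) (\<lambda>u v. \<phi> (br (\<psi> u) (\<psi> v)))"
proof -
  have comb: "a *\<^sub>R \<phi> x + b *\<^sub>R \<phi> y = \<phi> (a *\<^sub>R x + b *\<^sub>R y)" if "x \<in> L" "y \<in> L" for a b x y
    using linear_overD[OF \<phi>] that by simp
  have add: "\<phi> x + \<phi> y = \<phi> (x + y)" if "x \<in> L" "y \<in> L" for x y
    using linear_over_add[OF \<phi>] that by simp
  have scale: "a *\<^sub>R \<phi> x = \<phi> (a *\<^sub>R x)" if "x \<in> L" for a x
    using linear_over_scale[OF \<phi>] that by simp
  have zero: "\<phi> 0 = 0" using linear_over_0[OF \<phi> subspace_0[OF subspace]] .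
  note L = subspace_add[OF subspace] subspace_scale[OF subspace] subspace_0[OF subspace] closed
  obtain B where B: "finite B" "L = span B" using finite_dimensional by blast
  have "\<phi> ` L = span (\<phi> ` B)"
    using linear_over_span_image[OF \<phi> subspace, of B] B(2) by (simp add: span_superset)
  then have "\<exists>B'. finite B' \<and> \<phi> ` L = span B'" using B(1) by blast
  then show ?thesis
    by unfold_locales
      (auto simp: add scale \<psi> L add_left add_right scale_left scale_right alternating zero jacobi)
qed

end

section \<open>Weighted Lie algebras: forms are determined by homogeneous arguments\<close>

text \<open>
  The axioms are stated elementwise, without direct sums, so that they carry over along injective
  linear maps. \<open>U 0\<close> is unconstrained; the weight-0 part of \<open>L\<close> is the line through \<open>e\<close>.
\<close>

locale weighted_lie_algebra = lie_algebra L br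
  for L :: "'a::real_vector set" and br +
  fixes e :: 'a and U :: "nat \<Rightarrow> 'a set" and p :: "nat \<Rightarrow> 'a \<Rightarrow> 'a" and r :: nat
  assumes e_in: "e \<in> L"
    and U_subset: "1 \<le> i \<Longrightarrow> U i \<subseteq> L"
    and L_subset_span: "L \<subseteq> span (insert e (\<Union>i\<in>{1..}. U i))"
    and br_e: "\<lbrakk>1 \<le> i; x \<in> U i\<rbrakk> \<Longrightarrow> br e x = real i *\<^sub>R x"
    and br_U: "\<lbrakk>1 \<le> i; 1 \<le> j; x \<in> U i; y \<in> U j\<rbrakk> \<Longrightarrow> br x y \<in> U (i + j)"
    and U_trivial: "r < i \<Longrightarrow> U i = {0}"
    and p_in: "x \<in> L \<Longrightarrow> p i x \<in> L"
    and p_linear: "linear_over L (p i)"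
    and p_e: "p i e = 0"
    and p_U: "\<lbrakk>1 \<le> j; x \<in> U j\<rbrakk> \<Longrightarrow> p i x = (if i = j then x else 0)"
begin

lemma homogeneous_eq:
  assumes F: "linear_over L F" "linear_over L G" and "F e = G e"
    and "\<And>i x. \<lbrakk>1 \<le> i; x \<in> U i; x \<in> L\<rbrakk> \<Longrightarrow> F x = G x" and "x \<in> L"
  shows "F x = G x"
proof (rule linear_over_eq_on_span[OF F subspace])
  show "insert e (\<Union>i\<in>{1..}. U i) \<subseteq> L" using e_in U_subset by auto
  show "F x = G x" if "x \<in> insert e (\<Union>i\<in>{1..}. U i)" for x
    using that assms(3,4) U_subset by fastforce
  show "x \<in> span (insert e (\<Union>i\<in>{1..}. U i))" using assms(5) L_subset_span by blast
qed

text \<open>By bilinearity it suffices to compare on \<open>e\<close> and homogeneous elements.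
  Alternation disposes of the pair \<open>e\<close>, \<open>e\<close>, and antisymmetry moves
  \<open>e\<close> to the front, which leaves two cases.\<close>

lemma alternating_form_2_eq:
  assumes FG: "\<And>x. x \<in> L \<Longrightarrow> linear_over L (F x)" "\<And>y. y \<in> L \<Longrightarrow> linear_over L (\<lambda>x. F x y)"
    "\<And>x. x \<in> L \<Longrightarrow> linear_over L (G x)" "\<And>y. y \<in> L \<Longrightarrow> linear_over L (\<lambda>x. G x y)"
    and alt: "\<And>x. x \<in> L \<Longrightarrow> F x x = 0" "\<And>x. x \<in> L \<Longrightarrow> G x x = 0"
    and e: "\<And>j y. \<lbrakk>1 \<le> j; y \<in> U j; y \<in> L\<rbrakk> \<Longrightarrow> F e y = G e y"
    and U: "\<And>i j x y. \<lbrakk>1 \<le> i; x \<in> U i; x \<in> L; 1 \<le> j; y \<in> U j; y \<in> L\<rbrakk> \<Longrightarrow> F x y = G x y"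
    and xy: "x \<in> L" "y \<in> L"
  shows "F x y = G x y"
proof (rule homogeneous_eq[of "\<lambda>x. F x y" "\<lambda>x. G x y"])
  have anti: "F a b = - F b a" "G a b = - G b a" if "a \<in> L" "b \<in> L" for a b
    using FG alt that by (auto intro!: bilinear_alternating_antisym[of L] subspace)
  show "F e y = G e y"
    by (rule homogeneous_eq) (use FG xy e_in alt e in auto)
  show "F x y = G x y" if x: "1 \<le> i" "x \<in> U i" "x \<in> L" for i x
    by (rule homogeneous_eq) (use FG xy e_in e U x anti[of x e] in auto)
qed (use FG xy in auto)

text \<open>Freezing the first argument leaves an alternating 2-form, so the degree 2 criterion
  applies. When \<open>e\<close> comes second, antisymmetry in the first two arguments brings it to
  the front.\<close>

lemma alternating_form_3_eq:
  assumes F: "\<And>y z. \<lbrakk>y \<in> L; z \<in> L\<rbrakk> \<Longrightarrow> linear_over L (\<lambda>x. F x y z)"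
    "\<And>x z. \<lbrakk>x \<in> L; z \<in> L\<rbrakk> \<Longrightarrow> linear_over L (\<lambda>y. F x y z)"
    "\<And>x y. \<lbrakk>x \<in> L; y \<in> L\<rbrakk> \<Longrightarrow> linear_over L (\<lambda>z. F x y z)"
    and G: "\<And>y z. \<lbrakk>y \<in> L; z \<in> L\<rbrakk> \<Longrightarrow> linear_over L (\<lambda>x. G x y z)"
    "\<And>x z. \<lbrakk>x \<in> L; z \<in> L\<rbrakk> \<Longrightarrow> linear_over L (\<lambda>y. G x y z)"
    "\<And>x y. \<lbrakk>x \<in> L; y \<in> L\<rbrakk> \<Longrightarrow> linear_over L (\<lambda>z. G x y z)"
    and altF: "\<And>x y. \<lbrakk>x \<in> L; y \<in> L\<rbrakk> \<Longrightarrow> F x x y = 0" "\<And>x y. \<lbrakk>x \<in> L; y \<in> L\<rbrakk> \<Longrightarrow> F y x x = 0"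
    and altG: "\<And>x y. \<lbrakk>x \<in> L; y \<in> L\<rbrakk> \<Longrightarrow> G x x y = 0" "\<And>x y. \<lbrakk>x \<in> L; y \<in> L\<rbrakk> \<Longrightarrow> G y x x = 0"
    and e: "\<And>i j x y. \<lbrakk>1 \<le> i; x \<in> U i; x \<in> L; 1 \<le> j; y \<in> U j; y \<in> L\<rbrakk> \<Longrightarrow> F e x y = G e x y"
    and U: "\<And>i j l x y z. \<lbrakk>1 \<le> i; x \<in> U i; x \<in> L; 1 \<le> j; y \<in> U j; y \<in> L;
      1 \<le> l; z \<in> U l; z \<in> L\<rbrakk> \<Longrightarrow> F x y z = G x y z"
    and xyz: "x \<in> L" "y \<in> L" "z \<in> L"
  shows "F x y z = G x y z"
proof (rule homogeneous_eq[of "\<lambda>x. F x y z" "\<lambda>x. G x y z"])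
  have anti: "F a b c = - F b a c" "G a b c = - G b a c" if "a \<in> L" "b \<in> L" "c \<in> L" for a b c
    using bilinear_alternating_antisym[of L "\<lambda>a b. F a b c" a b]
      bilinear_alternating_antisym[of L "\<lambda>a b. G a b c" a b] F G altF altG that subspace by auto
  \<comment> \<open>The case of a second argument \<open>e\<close> is trivial here: both forms
    vanish on a repeated \<open>e\<close>.\<close>
  have e2: "F e y z = G e y z" if "y \<in> L" "z \<in> L" for y z
    by (rule alternating_form_2_eq[of "F e" "G e"]) (use F G altF altG e e_in that in auto)
  then show "F e y z = G e y z" using xyz by simp
  show "F x y z = G x y z" if x: "1 \<le> i" "x \<in> U i" "x \<in> L" for i x
  proof (rule alternating_form_2_eq[of "F x" "G x"])
    show "F x e y = G x e y" if "y \<in> L" for y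
      using anti[of x e y] e2[of x y] x e_in that by simp
  qed (use F G altF altG U x xyz in auto)
qed (use F G xyz in auto)

text \<open>Only the term \<open>i = j\<close> survives; for \<open>j\<close> above \<open>r\<close>
  the element is 0 and both sides vanish. It evaluates sums over weight components at homogeneous
  elements.\<close>

lemma sum_projections:
  assumes "1 \<le> j" "x \<in> U j" "\<And>i. f i 0 = (0::real)" "x \<in> L"
  shows "(\<Sum>i=1..r. f i (p i x)) = f j x"
proof (cases "j \<le> r")
  case True
  have "(\<Sum>i=1..r. f i (p i x)) = (\<Sum>i=1..r. if i = j then f j x else 0)"
    using assms by (intro sum.cong) (auto simp: p_U)
  then show ?thesis using True assms(1) by simp
next
  case False
  then have "x = 0" using U_trivial[of j] assms(2) by auto
  then show ?thesis using linear_over_0[OF p_linear e_in] assms(3) by simp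
qed

section \<open>Exactness of cocycles in degrees 2 and 3\<close>

lemma cocycles_2_exact: "cocycles L br 2 \<subseteq> coboundaries L br 2"
proof
  fix \<omega> assume "\<omega> \<in> cocycles L br 2"
  then have \<omega>: "\<omega> \<in> cochains L 2" and d: "ce_differential L br 2 \<omega> = 0"
    by (auto simp: cocycles_def)
  have lin1: "linear_over L (\<lambda>x. \<omega> [x, y])" if "y \<in> L" for y
    using cochain_linear[OF \<omega>, of "[]" "[y]"] that by simp
  have lin2: "linear_over L (\<lambda>y. \<omega> [x, y])" if "x \<in> L" for x
    using cochain_linear[OF \<omega>, of "[x]" "[]"] that by simp
  have alt0: "\<forall>xs\<in>tuples L 2. \<forall>i<2. \<forall>j<2. i \<noteq> j \<and> xs ! i = xs ! j \<longrightarrow> \<omega> xs = 0"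
    using \<omega> by (simp add: cochains_def)
  have alt: "\<omega> [x, x] = 0" if "x \<in> L" for x
    using that alt0[rule_format, of "[x, x]" 0 1] by (simp add: tuples_def)
  have anti: "\<omega> [x, y] = - \<omega> [y, x]" if "x \<in> L" "y \<in> L" for x y
    by (rule bilinear_alternating_antisym[of L "\<lambda>x y. \<omega> [x, y]"])
      (use lin1 lin2 alt that subspace in auto)
  have closed2: "- \<omega> [br x y, z] + \<omega> [br x z, y] - \<omega> [br y z, x] = 0"
    if "x \<in> L" "y \<in> L" "z \<in> L" for x y z
    using fun_cong[OF d, of "[x, y, z]"] that
    by (simp add: ce_differential_2)
  \<comment> \<open>The contraction with \<open>e\<close> divided by the weight. The minus sign
    makes the result a primitive of \<open>\<omega>\<close> itself, and starting at weight 1 avoids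
    a zero divisor.\<close>
  define b where "b x = - (\<Sum>i=1..r. \<omega> [e, p i x] / i)" for x
  define \<beta> where "\<beta> xs = (if xs \<in> tuples L 1 then b (hd xs) else 0)" for xs
  have b_lin: "linear_over L b"
  proof (rule linear_overI)
    fix x y s t assume xy: "x \<in> L" "y \<in> L"
    then have "\<omega> [e, p i (s *\<^sub>R x + t *\<^sub>R y)] = s * \<omega> [e, p i x] + t * \<omega> [e, p i y]" for i
      using linear_overD[OF p_linear xy] linear_overD[OF lin2[OF e_in]] p_in by simp
    then show "b (s *\<^sub>R x + t *\<^sub>R y) = s *\<^sub>R b x + t *\<^sub>R b y"
      by (simp add: b_def sum.distrib add_divide_distrib sum_distrib_left)
  qed
  have b_U: "b x = - \<omega> [e, x] / i" if "1 \<le> i" "x \<in> U i" for i x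
    using sum_projections[of i x "\<lambda>i x. \<omega> [e, x] / i"] that linear_over_0[OF lin2[OF e_in] e_in] U_subset[of i]
    by (auto simp: b_def)
  have \<beta>: "\<beta> \<in> cochains L 1"
    using linear_overD[OF b_lin] by (auto simp: cochains_def \<beta>_def tuples_def length_Suc_conv linear_combination_in_L)
  \<comment> \<open>The right side is the differential of the 1-form \<open>b\<close>. Both sides
    are bilinear and alternating, so homogeneous arguments suffice.\<close>
  have eq: "\<omega> [x, y] = - b (br x y)" if "x \<in> L" "y \<in> L" for x y
  proof (rule alternating_form_2_eq[of "\<lambda>x y. \<omega> [x, y]" "\<lambda>x y. - b (br x y)"])
    show "linear_over L (\<lambda>y. - b (br x y))" if "x \<in> L" for x
      by (rule linear_overI)
        (simp add: linear_overD[OF br_linear_right] linear_overD[OF b_lin] that closed)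
    show "linear_over L (\<lambda>x. - b (br x y))" if "y \<in> L" for y
      by (rule linear_overI)
        (simp add: linear_overD[OF br_linear_left] linear_overD[OF b_lin] that closed)
    show "- b (br x x) = 0" if "x \<in> L" for x
      using that alternating linear_over_0[OF b_lin] by simp
    \<comment> \<open>The factor \<open>j\<close> from \<open>br e y\<close> cancels the division by
      the weight in \<open>b\<close>.\<close>
    show "\<omega> [e, y] = - b (br e y)" if "1 \<le> j" "y \<in> U j" "y \<in> L" for j y
      using that by (simp add: br_e linear_over_scale[OF b_lin] b_U)
    show "\<omega> [x, y] = - b (br x y)"
      if "1 \<le> i" "x \<in> U i" "x \<in> L" "1 \<le> j" "y \<in> U j" "y \<in> L" for i j x y
    proof -
      \<comment> \<open>Closedness at \<open>e\<close>, \<open>x\<close>, \<open>y\<close>: the two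
        brackets with \<open>e\<close> contribute the weights \<open>i\<close> and
        \<open>j\<close>.\<close>
      have "real (i + j) * \<omega> [x, y] = \<omega> [e, br x y]"
        using closed2[OF e_in, of x y] that anti[of y x] anti[of "br x y" e] e_in
        by (simp add: br_e linear_over_scale[OF lin1] closed algebra_simps)
      moreover have "b (br x y) = - \<omega> [e, br x y] / real (i + j)"
        using b_U[of "i + j" "br x y"] br_U that by simp
      ultimately show ?thesis using that(1) by (simp add: eq_divide_eq mult.commute)
    qed
  qed (use lin1 lin2 alt that in auto)
  have "\<omega> = ce_differential L br 1 \<beta>"
  proof
    fix xs
    show "\<omega> xs = ce_differential L br 1 \<beta> xs"
    proof (cases "xs \<in> tuples L 2")
      case True
      then obtain x y where xs: "xs = [x, y]" "x \<in> L" "y \<in> L"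
        by (auto simp: tuples_def numeral_2_eq_2 length_Suc_conv)
      then show ?thesis
        using eq by (simp add: ce_differential_1 \<beta>_def tuples_def closed)
    next
      case False
      then show ?thesis using \<omega> by (auto simp: cochains_def ce_differential_def numeral_2_eq_2)
    qed
  qed
  with \<beta> show "\<omega> \<in> coboundaries L br 2" by (auto simp: coboundaries_def numeral_2_eq_2)
qed

text \<open>The argument of degree 2, with the contraction now a 2-form whose value on two
  homogeneous elements is divided by the sum of their weights.\<close>

lemma cocycles_3_exact: "cocycles L br 3 \<subseteq> coboundaries L br 3"
proof
  fix \<omega> assume "\<omega> \<in> cocycles L br 3"
  then have \<omega>: "\<omega> \<in> cochains L 3" and d: "ce_differential L br 3 \<omega> = 0"
    by (auto simp: cocycles_def)
  have lin1: "linear_over L (\<lambda>x. \<omega> [x, y, z])" if "y \<in> L" "z \<in> L" for y z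
    using cochain_linear[OF \<omega>, of "[]" "[y, z]"] that by simp
  have lin2: "linear_over L (\<lambda>y. \<omega> [x, y, z])" if "x \<in> L" "z \<in> L" for x z
    using cochain_linear[OF \<omega>, of "[x]" "[z]"] that by simp
  have lin3: "linear_over L (\<lambda>z. \<omega> [x, y, z])" if "x \<in> L" "y \<in> L" for x y
    using cochain_linear[OF \<omega>, of "[x, y]" "[]"] that by simp
  have alt0: "\<forall>xs\<in>tuples L 3. \<forall>i<3. \<forall>j<3. i \<noteq> j \<and> xs ! i = xs ! j \<longrightarrow> \<omega> xs = 0"
    using \<omega> by (simp add: cochains_def)
  have alt1: "\<omega> [x, x, y] = 0" if "x \<in> L" "y \<in> L" for x y
    using that alt0[rule_format, of "[x, x, y]" 0 1] by (simp add: tuples_def)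
  have alt2: "\<omega> [y, x, x] = 0" if "x \<in> L" "y \<in> L" for x y
    using that alt0[rule_format, of "[y, x, x]" 1 2] by (simp add: tuples_def)
  have anti1: "\<omega> [x, y, z] = - \<omega> [y, x, z]" if "x \<in> L" "y \<in> L" "z \<in> L" for x y z
    by (rule bilinear_alternating_antisym[of L "\<lambda>x y. \<omega> [x, y, z]"])
      (use lin1 lin2 alt1 that subspace in auto)
  have anti2: "\<omega> [x, y, z] = - \<omega> [x, z, y]" if "x \<in> L" "y \<in> L" "z \<in> L" for x y z
    by (rule bilinear_alternating_antisym[of L "\<lambda>y z. \<omega> [x, y, z]"])
      (use lin2 lin3 alt2 that subspace in auto)
  have closed3: "- \<omega> [br t x, y, z] + \<omega> [br t y, x, z] - \<omega> [br t z, x, y]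
      - \<omega> [br x y, t, z] + \<omega> [br x z, t, y] - \<omega> [br y z, t, x] = 0"
    if "t \<in> L" "x \<in> L" "y \<in> L" "z \<in> L" for t x y z
    using fun_cong[OF d, of "[t, x, y, z]"] that
    by (simp add: ce_differential_3)
  \<comment> \<open>Each argument is split into its weight components; the divisor
    \<open>i + j\<close> is the total weight, here at least 2. The sign is chosen as in degree
    2.\<close>
  define b where "b x y = - (\<Sum>i=1..r. \<Sum>j=1..r. \<omega> [e, p i x, p j y] / real (i + j))" for x y
  define \<beta> where "\<beta> xs = (if xs \<in> tuples L 2 then b (xs ! 0) (xs ! 1) else 0)" for xs
  have b_lin1: "linear_over L (\<lambda>x. b x y)" if y: "y \<in> L" for y
  proof (rule linear_overI)
    fix x x' s t assume x: "x \<in> L" "x' \<in> L"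
    then have "\<omega> [e, p i (s *\<^sub>R x + t *\<^sub>R x'), p j y]
        = s * \<omega> [e, p i x, p j y] + t * \<omega> [e, p i x', p j y]" for i j
      using linear_overD[OF p_linear x] linear_overD[OF lin2[OF e_in]] p_in y by simp
    then show "b (s *\<^sub>R x + t *\<^sub>R x') y = s *\<^sub>R b x y + t *\<^sub>R b x' y"
      by (simp add: b_def sum.distrib add_divide_distrib sum_distrib_left)
  qed
  \<comment> \<open>The divisor is symmetric in \<open>i\<close> and \<open>j\<close>, so after
    exchanging the sums the antisymmetry of \<open>\<omega>\<close> in its last two arguments passes
    to \<open>b\<close>.\<close>
  have b_anti: "b x y = - b y x" if xy: "x \<in> L" "y \<in> L" for x y
  proof -
    have "(\<Sum>i=1..r. \<Sum>j=1..r. \<omega> [e, p i x, p j y] / real (i + j))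
        = (\<Sum>j=1..r. \<Sum>i=1..r. \<omega> [e, p i x, p j y] / real (i + j))"
      by (rule sum.swap)
    also have "\<dots> = (\<Sum>j=1..r. \<Sum>i=1..r. - (\<omega> [e, p j y, p i x] / real (j + i)))"
    proof (intro sum.cong refl)
      fix i j show "\<omega> [e, p i x, p j y] / real (i + j) = - (\<omega> [e, p j y, p i x] / real (j + i))"
        using anti2[of e "p i x" "p j y"] p_in e_in xy by (simp add: add.commute)
    qed
    finally show ?thesis by (simp add: b_def sum_negf)
  qed
  have b_lin2: "linear_over L (\<lambda>y. b x y)" if x: "x \<in> L" for x
  proof (rule linear_overI)
    fix y y' s t assume y: "y \<in> L" "y' \<in> L"
    show "b x (s *\<^sub>R y + t *\<^sub>R y') = s *\<^sub>R b x y + t *\<^sub>R b x y'"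
      using b_anti[OF x linear_combination_in_L[OF y, of s t]] b_anti[OF x y(1)] b_anti[OF x y(2)]
        linear_overD[OF b_lin1[OF x] y, of s t] by simp
  qed
  have b_alt: "b x x = 0" if "x \<in> L" for x
    using b_anti[OF that that] by simp
  \<comment> \<open>The projections kill \<open>e\<close>. This removes the term
    \<open>b (br x y) e\<close> from the differential at \<open>e\<close>, \<open>x\<close>,
    \<open>y\<close>.\<close>
  have b_e: "b y e = 0" if "y \<in> L" for y
    using that p_in e_in linear_over_0[OF lin3[OF e_in p_in[OF that]] e_in] by (simp add: b_def p_e)
  have b_U: "b x y = - \<omega> [e, x, y] / real (i + j)"
    if x: "1 \<le> i" "x \<in> U i" and y: "1 \<le> j" "y \<in> U j" for i j x y
  proof -
    have xy: "x \<in> L" "y \<in> L" using x y U_subset by auto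
    have "(\<Sum>j=1..r. \<omega> [e, p i' x, p j y] / real (i' + j)) = \<omega> [e, p i' x, y] / real (i' + j)" for i'
      using sum_projections[OF y, of "\<lambda>j y. \<omega> [e, p i' x, y] / real (i' + j)"] xy p_in
        linear_over_0[OF lin3[OF e_in] e_in] by simp
    moreover have "(\<Sum>i=1..r. \<omega> [e, p i x, y] / real (i + j)) = \<omega> [e, x, y] / real (i + j)"
      using sum_projections[OF x, of "\<lambda>i x. \<omega> [e, x, y] / real (i + j)"] xy
        linear_over_0[OF lin2[OF e_in] e_in] by simp
    ultimately show ?thesis by (simp add: b_def)
  qed
  have \<beta>: "\<beta> \<in> cochains L 2"
    using linear_overD[OF b_lin1] linear_overD[OF b_lin2] b_alt
    by (auto simp: cochains_def \<beta>_def tuples_def length_Suc_conv linear_combination_in_L numeral_2_eq_2 less_Suc_eq)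
  let ?d = "\<lambda>x y z. - b (br x y) z + b (br x z) y - b (br y z) x"
  note lin = linear_overD[OF br_linear_right] linear_overD[OF br_linear_left]
    linear_overD[OF b_lin1] linear_overD[OF b_lin2]
  have eq: "\<omega> [x, y, z] = ?d x y z" if "x \<in> L" "y \<in> L" "z \<in> L" for x y z
  proof (rule alternating_form_3_eq[of "\<lambda>x y z. \<omega> [x, y, z]" ?d])
    show "linear_over L (\<lambda>x. ?d x y z)" if "y \<in> L" "z \<in> L" for y z
      by (rule linear_overI) (simp add: lin that closed algebra_simps)
    show "linear_over L (\<lambda>y. ?d x y z)" if "x \<in> L" "z \<in> L" for x z
      by (rule linear_overI) (simp add: lin that closed algebra_simps)
    show "linear_over L (\<lambda>z. ?d x y z)" if "x \<in> L" "y \<in> L" for x y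
      by (rule linear_overI) (simp add: lin that closed algebra_simps)
    show "?d x x y = 0" if "x \<in> L" "y \<in> L" for x y
      using that linear_over_0[OF b_lin1] by (simp add: alternating)
    show "?d y x x = 0" if "x \<in> L" "y \<in> L" for x y
      using that linear_over_0[OF b_lin1] by (simp add: alternating)
    show "\<omega> [e, x, y] = ?d e x y"
      if "1 \<le> i" "x \<in> U i" "x \<in> L" "1 \<le> j" "y \<in> U j" "y \<in> L" for i j x y
    proof -
      have "?d e x y = - real (i + j) * b x y"
        using that b_anti[of y x] b_e[of "br x y"] linear_over_scale[OF b_lin1]
        by (simp add: br_e closed algebra_simps)
      moreover have "real (i + j) * b x y = - \<omega> [e, x, y]"
        using b_U[of i x j y] that by simp
      ultimately show ?thesis by (simp add: algebra_simps)
    qed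
    show "\<omega> [x, y, z] = ?d x y z"
      if x: "1 \<le> i" "x \<in> U i" "x \<in> L" and y: "1 \<le> j" "y \<in> U j" "y \<in> L"
        and z: "1 \<le> l" "z \<in> U l" "z \<in> L" for i j l x y z
    proof -
      define w where "w = real (i + j + l)"
      have w: "w \<noteq> 0" using x(1) by (simp add: w_def)
      \<comment> \<open>Closedness at \<open>e\<close>, \<open>x\<close>, \<open>y\<close>,
        \<open>z\<close>: the three brackets with \<open>e\<close> contribute the weights
        \<open>i\<close>, \<open>j\<close>, \<open>l\<close>, and permuting arguments collects them
        into \<open>- w\<close>.\<close>
      have "- w * \<omega> [x, y, z] + \<omega> [e, br x y, z] - \<omega> [e, br x z, y] + \<omega> [e, br y z, x] = 0"
        using closed3[OF e_in x(3) y(3) z(3)] x y z e_in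
          anti1[of y x z] anti1[of z x y] anti2[of x z y]
          anti1[of "br x y" e z] anti1[of "br x z" e y] anti1[of "br y z" e x]
        by (simp add: w_def br_e linear_over_scale[OF lin1] closed algebra_simps)
      \<comment> \<open>Bracketing adds weights, so all three pairs have the same total weight
        \<open>w\<close> and a single division serves them all.\<close>
      moreover have "b (br x y) z = - \<omega> [e, br x y, z] / w"
          "b (br x z) y = - \<omega> [e, br x z, y] / w" "b (br y z) x = - \<omega> [e, br y z, x] / w"
        using b_U[OF _ br_U[OF x(1) y(1) x(2) y(2)] z(1,2)] b_U[OF _ br_U[OF x(1) z(1) x(2) z(2)] y(1,2)]
          b_U[OF _ br_U[OF y(1) z(1) y(2) z(2)] x(1,2)] x(1) y(1)
        by (simp_all add: w_def ac_simps)
      then have "\<omega> [e, br x y, z] = - w * b (br x y) z"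
          "\<omega> [e, br x z, y] = - w * b (br x z) y" "\<omega> [e, br y z, x] = - w * b (br y z) x"
        using w by simp_all
      ultimately have "w * \<omega> [x, y, z] = w * ?d x y z" by (simp add: algebra_simps)
      then show ?thesis using w by simp
    qed
  qed (use lin1 lin2 lin3 alt1 alt2 that in auto)
  have "\<omega> = ce_differential L br 2 \<beta>"
  proof
    fix xs
    show "\<omega> xs = ce_differential L br 2 \<beta> xs"
    proof (cases "xs \<in> tuples L 3")
      case True
      then obtain x y z where xs: "xs = [x, y, z]" "x \<in> L" "y \<in> L" "z \<in> L"
        by (auto simp: tuples_def numeral_3_eq_3 length_Suc_conv)
      then show ?thesis
        using eq by (simp add: ce_differential_2 \<beta>_def tuples_def closed)
    next
      case False
      then show ?thesis using \<omega> by (auto simp: cochains_def ce_differential_def eval_nat_numeral)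
    qed
  qed
  with \<beta> show "\<omega> \<in> coboundaries L br 3" by (auto simp: coboundaries_def eval_nat_numeral)
qed

section \<open>Vanishing Betti numbers, and transport of the weighted structure\<close>

lemma zero_in_coboundaries: "0 \<in> coboundaries L br (Suc n)"
proof -
  have "(0 :: 'a list \<Rightarrow> real) \<in> cochains L n" by (auto simp: cochains_def)
  moreover have "ce_differential L br n 0 = 0" by (auto simp: ce_differential_def fun_eq_iff)
  ultimately show ?thesis unfolding coboundaries_def by (auto intro: image_eqI[where x = 0])
qed

lemma two_three_trivial: "two_three_trivial L br"
  using quotient_dim_eq_0[OF cocycles_2_exact] quotient_dim_eq_0[OF cocycles_3_exact]
    zero_in_coboundaries[of 1] zero_in_coboundaries[of 2]
  by (simp add: two_three_trivial_def betti_def eval_nat_numeral)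

text \<open>Carries all weight data along \<open>\<phi>\<close>, so that the vanishing result
  applies to a copy of the algebra in another ambient space.\<close>

lemma weighted_image:
  assumes \<phi>: "linear_over L \<phi>" and \<psi>: "\<And>x. x \<in> L \<Longrightarrow> \<psi> (\<phi> x) = x"
  shows "weighted_lie_algebra (\<phi> ` L) (\<lambda>u v. \<phi> (br (\<psi> u) (\<psi> v))) (\<phi> e) (\<lambda>i. \<phi> ` U i)
    (\<lambda>i u. \<phi> (p i (\<psi> u))) r"
proof -
  interpret img: lie_algebra "\<phi> ` L" "\<lambda>u v. \<phi> (br (\<psi> u) (\<psi> v))"
    using lie_algebra_image assms by blast
  have UL: "x \<in> L" if "1 \<le> i" "x \<in> U i" for i x using that U_subset by blast
  have zero: "\<phi> 0 = 0" using linear_over_0[OF \<phi> e_in] .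
  have "span (\<phi> ` insert e (\<Union>i\<in>{1..}. U i)) = \<phi> ` span (insert e (\<Union>i\<in>{1..}. U i))"
    using e_in UL by (intro linear_over_span_image[OF \<phi> subspace]) auto
  then have span: "\<phi> x \<in> span (insert (\<phi> e) (\<Union>i\<in>{1..}. \<phi> ` U i))" if "x \<in> L" for x
    using that L_subset_span by (auto simp: image_UN)
  show ?thesis
  proof unfold_locales
    show "linear_over (\<phi> ` L) (\<lambda>u. \<phi> (p i (\<psi> u)))" for i
    proof (rule linear_overI)
      fix u v a b assume "u \<in> \<phi> ` L" "v \<in> \<phi> ` L"
      then obtain x y where [simp]: "u = \<phi> x" "v = \<phi> y" and xy: "x \<in> L" "y \<in> L" by blast
      have "\<phi> (p i (\<psi> (a *\<^sub>R u + b *\<^sub>R v))) = \<phi> (p i (a *\<^sub>R x + b *\<^sub>R y))"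
        using linear_overD[OF \<phi> xy, of a b] \<psi>[OF linear_combination_in_L[OF xy, of a b]] by simp
      then show "\<phi> (p i (\<psi> (a *\<^sub>R u + b *\<^sub>R v))) = a *\<^sub>R \<phi> (p i (\<psi> u)) + b *\<^sub>R \<phi> (p i (\<psi> v))"
        using xy by (simp add: \<psi> linear_overD[OF p_linear] linear_overD[OF \<phi>] p_in)
    qed
  qed (use e_in UL span br_U in \<open>auto simp: \<psi> br_e linear_over_scale[OF \<phi>] U_trivial p_in p_e p_U zero\<close>)
qed

end


section \<open>Extension of a graded algebra by its degree derivation\<close>

text \<open>The direct sum is expressed by its projections: \<open>p_V_mem\<close> and
  \<open>p_sum\<close> give existence of the decomposition, \<open>p_lin\<close> and
  \<open>p_V\<close> its uniqueness. \<open>V 0\<close> is left unconstrained.\<close>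

locale graded_lie_algebra = lie_algebra L br
  for L :: "'a::real_vector set" and br +
  fixes V :: "nat \<Rightarrow> 'a set" and p :: "nat \<Rightarrow> 'a \<Rightarrow> 'a" and r :: nat
  assumes V_subset: "1 \<le> i \<Longrightarrow> V i \<subseteq> L"
    and br_V: "\<lbrakk>1 \<le> i; 1 \<le> j; x \<in> V i; y \<in> V j\<rbrakk> \<Longrightarrow> br x y \<in> V (i + j)"
    and V_trivial: "r < i \<Longrightarrow> V i = {0}"
    and p_V_mem: "\<lbrakk>i \<in> {1..r}; x \<in> L\<rbrakk> \<Longrightarrow> p i x \<in> V i"
    and p_in_L: "x \<in> L \<Longrightarrow> p i x \<in> L"
    and p_lin: "linear_over L (p i)"
    and p_V: "\<lbrakk>1 \<le> j; x \<in> V j\<rbrakk> \<Longrightarrow> p i x = (if i = j then x else 0)"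
    and p_sum: "x \<in> L \<Longrightarrow> (\<Sum>i=1..r. p i x) = x"
begin

lemma V_in_L: "\<lbrakk>1 \<le> i; x \<in> V i\<rbrakk> \<Longrightarrow> x \<in> L"
  using V_subset by blast

definition D :: "'a \<Rightarrow> 'a" where
  "D x = (\<Sum>i=1..r. real i *\<^sub>R p i x)"

lemma D_in: "x \<in> L \<Longrightarrow> D x \<in> L"
  unfolding D_def by (intro subspace_sum[OF subspace] subspace_scale[OF subspace] p_in_L)

lemma D_lin: "linear_over L D"
  by (rule linear_overI)
    (simp add: D_def linear_overD[OF p_lin] sum.distrib scaleR_sum_right algebra_simps)

lemma D_V: assumes "1 \<le> j" "x \<in> V j" shows "D x = real j *\<^sub>R x"
proof (cases "j \<le> r")
  case True
  have "D x = (\<Sum>i=1..r. if i = j then real j *\<^sub>R x else 0)"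
    unfolding D_def using assms by (intro sum.cong) (auto simp: p_V)
  then show ?thesis using True assms(1) by simp
next
  case False
  then show ?thesis
    using assms V_trivial[of j] linear_over_0[OF D_lin subspace_0[OF subspace]] by simp
qed

lemma L_span_V: "L \<subseteq> span (\<Union>i\<in>{1..}. V i)"
proof
  fix x assume x: "x \<in> L"
  have "(\<Sum>i=1..r. p i x) \<in> span (\<Union>i\<in>{1..}. V i)"
    using p_V_mem x by (intro span_sum span_base) force
  then show "x \<in> span (\<Union>i\<in>{1..}. V i)" using p_sum[OF x] by simp
qed

lemma graded_eq:
  assumes F: "linear_over L F" "linear_over L G"
    and "\<And>i x. \<lbrakk>1 \<le> i; x \<in> V i; x \<in> L\<rbrakk> \<Longrightarrow> F x = G x" and "x \<in> L"
  shows "F x = G x"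
proof (rule linear_over_eq_on_span[OF F subspace])
  show "(\<Union>i\<in>{1..}. V i) \<subseteq> L" using V_subset by auto
  show "F x = G x" if "x \<in> (\<Union>i\<in>{1..}. V i)" for x
    using that assms(3) V_subset by fastforce
  show "x \<in> span (\<Union>i\<in>{1..}. V i)" using assms(4) L_span_V by blast
qed

text \<open>For homogeneous \<open>x\<close> and \<open>y\<close> both sides equal
  \<open>i + j\<close> times the bracket, because weights add. Linearity extends this one argument
  at a time.\<close>

lemma D_derivation:
  assumes xy: "x \<in> L" "y \<in> L"
  shows "D (br x y) = br (D x) y + br x (D y)"
proof (rule graded_eq[of "\<lambda>x. D (br x y)" "\<lambda>x. br (D x) y + br x (D y)"])
  note lin = linear_overD[OF br_linear_right] linear_overD[OF br_linear_left] linear_overD[OF D_lin]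
  show "linear_over L (\<lambda>x. D (br x y))" "linear_over L (\<lambda>x. br (D x) y + br x (D y))"
    using xy by (auto intro!: linear_overI simp: lin closed D_in algebra_simps)
  fix i x assume x: "1 \<le> i" "x \<in> V i" "x \<in> L"
  show "D (br x y) = br (D x) y + br x (D y)"
  proof (rule graded_eq[of "\<lambda>y. D (br x y)" "\<lambda>y. br (D x) y + br x (D y)"])
    show "linear_over L (\<lambda>y. D (br x y))" "linear_over L (\<lambda>y. br (D x) y + br x (D y))"
      using x by (auto intro!: linear_overI simp: lin closed D_in algebra_simps)
    fix j y assume y: "1 \<le> j" "y \<in> V j" "y \<in> L"
    have "D (br x y) = real (i + j) *\<^sub>R br x y"
      using x y by (intro D_V br_V) auto
    then show "D (br x y) = br (D x) y + br x (D y)"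
      using x y by (simp add: D_V[of i] D_V[of j] scale_left scale_right algebra_simps)
  qed (use xy in auto)
qed (use xy in auto)

text \<open>The semidirect product of the line \<real> with \<open>L\<close>, where 1 acts by
  \<open>D\<close>; the pair \<open>(1, 0)\<close> is the element \<open>e\<close>.\<close>

definition ext_br :: "real \<times> 'a \<Rightarrow> real \<times> 'a \<Rightarrow> real \<times> 'a" where
  "ext_br u v = (0, br (snd u) (snd v) + fst u *\<^sub>R D (snd v) - fst v *\<^sub>R D (snd u))"

lemma br_0_left: "x \<in> L \<Longrightarrow> br 0 x = 0"
  using br_antisym[of 0 x] br_0_right[of x] subspace_0[OF subspace] by simp

text \<open>In the Jacobi identity the terms without \<open>D\<close> cancel by Jacobi in
  \<open>L\<close>, those with one \<open>D\<close> by the Leibniz rule, and those with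
  \<open>D\<close> applied twice in pairs.\<close>

lemma ext_lie_algebra: "lie_algebra (UNIV \<times> L) ext_br"
proof
  note L = subspace_add[OF subspace] subspace_diff[OF subspace] subspace_scale[OF subspace]
    subspace_0[OF subspace] closed D_in
  note lin = add_left add_right scale_left scale_right linear_over_add[OF D_lin]
    linear_over_scale[OF D_lin]
  show "subspace (UNIV \<times> L)" by (intro subspace_Times subspace_UNIV subspace)
  obtain B where B: "finite B" "L = span B" using finite_dimensional by blast
  have "linear_over L (Pair (0::real))" by (simp add: linear_over_def)
  then have span: "span (Pair (0::real) ` B) = Pair 0 ` L"
    using linear_over_span_image[OF _ subspace, of _ B] B(2) by (simp add: span_superset)
  have "u \<in> span (insert (1, 0) (Pair 0 ` B))" if u: "u \<in> UNIV \<times> L" for u :: "real \<times> 'a"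
  proof -
    have "(0, snd u) \<in> span (Pair (0::real) ` B)" unfolding span using u by auto
    then have "(0, snd u) \<in> span (insert (1, 0) (Pair (0::real) ` B))"
      using span_mono[OF subset_insertI] by blast
    moreover have "fst u *\<^sub>R (1, 0) \<in> span (insert (1, 0) (Pair (0::real) ` B))"
      by (intro span_scale span_base) simp
    ultimately have "fst u *\<^sub>R (1, 0) + (0, snd u) \<in> span (insert (1, 0) (Pair (0::real) ` B))"
      by (rule span_add[rotated])
    then show ?thesis by simp
  qed
  moreover have "span (insert (1, 0) (Pair 0 ` B)) \<subseteq> UNIV \<times> L"
    using B L by (intro span_minimal subspace_Times subspace_UNIV subspace) (auto intro: span_base)
  ultimately show "\<exists>B. finite B \<and> (UNIV :: real set) \<times> L = span B"
    using B(1) by (intro exI[of _ "insert (1, 0) (Pair 0 ` B)"]) auto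
  fix x y z :: "real \<times> 'a" assume x: "x \<in> UNIV \<times> L"
  show "ext_br x x = 0" using x by (auto simp: ext_br_def alternating zero_prod_def)
  assume y: "y \<in> UNIV \<times> L"
  show "ext_br x y \<in> UNIV \<times> L" using x y by (auto simp: ext_br_def L)
  show "ext_br (c *\<^sub>R x) y = c *\<^sub>R ext_br x y" "ext_br x (c *\<^sub>R y) = c *\<^sub>R ext_br x y" for c
    using x y by (auto simp: ext_br_def lin algebra_simps)
  assume z: "z \<in> UNIV \<times> L"
  show "ext_br (x + y) z = ext_br x z + ext_br y z" "ext_br x (y + z) = ext_br x y + ext_br x z"
    using x y z by (auto simp: ext_br_def lin algebra_simps)
  have diff: "br a (b - c) = br a b - br a c" "D (b - c) = D b - D c"
    if "a \<in> L" "b \<in> L" "c \<in> L" for a b c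
    using linear_overD[OF br_linear_right, of a b c 1 "-1"] linear_overD[OF D_lin, of b c 1 "-1"] that
    by auto
  obtain a b c x' y' z' where eqs: "x = (a, x')" "y = (b, y')" "z = (c, z')"
    and mem: "x' \<in> L" "y' \<in> L" "z' \<in> L"
    using x y z by auto
  have mem': "D x' \<in> L" "D y' \<in> L" "D z' \<in> L" using D_in mem by auto
  \<comment> \<open>Oriented so that \<open>D\<close> always ends up in the right argument of a
    bracket; mixed terms then reach a common form and cancel.\<close>
  have anti: "br (D x') y' = - br y' (D x')" "br (D y') z' = - br z' (D y')"
    "br (D z') x' = - br x' (D z')" "br (D z') y' = - br y' (D z')"
    "br (D x') z' = - br z' (D x')" "br (D y') x' = - br x' (D y')"
    using br_antisym mem mem' by blast+
  have jac: "br x' (br y' z') = - br y' (br z' x') - br z' (br x' y')"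
    using jacobi[OF mem] by (simp add: eq_diff_eq eq_neg_iff_add_eq_0 ac_simps)
  show "ext_br x (ext_br y z) + ext_br y (ext_br z x) + ext_br z (ext_br x y) = 0"
    using mem mem' by (simp add: eqs ext_br_def zero_prod_def lin diff L D_derivation anti jac algebra_simps)
qed

text \<open>Bracketing with \<open>(1, 0)\<close> is \<open>D\<close> on the copy of
  \<open>L\<close>, hence multiplication by \<open>i\<close> on \<open>V i\<close>. The projections
  ignore the real coordinate and so kill \<open>(1, 0)\<close>.\<close>

lemma ext_weighted:
  "weighted_lie_algebra (UNIV \<times> L) ext_br (1, 0) (\<lambda>i. Pair 0 ` V i) (\<lambda>i u. (0, p i (snd u))) r"
proof -
  interpret ext: lie_algebra "UNIV \<times> L" ext_br by (rule ext_lie_algebra)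
  have zero: "0 \<in> L" by (rule subspace_0[OF subspace])
  have D0: "D 0 = 0" using linear_over_0[OF D_lin zero] .
  have p0: "p i 0 = 0" for i using linear_over_0[OF p_lin zero] .
  have span: "u \<in> span (insert (1, 0) (\<Union>i\<in>{1..}. Pair 0 ` V i))" (is "_ \<in> span ?T")
    if u: "u \<in> UNIV \<times> L" for u :: "real \<times> 'a"
  proof -
    have "u = fst u *\<^sub>R (1, 0) + (\<Sum>i=1..r. (0, p i (snd u)))"
      using p_sum[of "snd u"] u by (auto simp: prod_eq_iff fst_sum snd_sum)
    also have "\<dots> \<in> span ?T"
      using p_V_mem u by (intro span_add span_scale span_sum span_base) force+
    finally show ?thesis .
  qed
  show ?thesis
  proof unfold_locales
    show "linear_over (UNIV \<times> L) (\<lambda>u. (0, p i (snd u)))" for i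
      by (rule linear_overI) (auto simp: linear_overD[OF p_lin])
  qed (use zero V_in_L span br_V in \<open>auto simp: ext_br_def D0 p0 D_V br_0_left V_trivial p_in_L
      p_V zero_prod_def\<close>)
qed

text \<open>Brackets have real coordinate 0. Conversely, a component of weight \<open>i\<close> is
  \<open>1 / i\<close> times its bracket with \<open>(1, 0)\<close>, and \<open>i\<close> is at
  least 1.\<close>

lemma ext_derived_algebra: "derived_algebra (UNIV \<times> L) ext_br = {0} \<times> L"
proof
  show "derived_algebra (UNIV \<times> L) ext_br \<subseteq> {0} \<times> L"
    unfolding derived_algebra_def bracket_span_def
  proof (rule span_minimal)
    show "subspace ({0} \<times> L)" by (intro subspace_Times subspace_single_0 subspace)
  qed (auto simp: ext_br_def closed D_in subspace_add[OF subspace] subspace_diff[OF subspace]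
      subspace_scale[OF subspace])
  interpret ext: weighted_lie_algebra "UNIV \<times> L" ext_br "(1, 0)" "\<lambda>i. Pair 0 ` V i"
    "\<lambda>i u. (0, p i (snd u))" r by (rule ext_weighted)
  show "{0} \<times> L \<subseteq> derived_algebra (UNIV \<times> L) ext_br"
  proof
    fix u assume "u \<in> {0::real} \<times> L"
    then obtain x where u: "u = (0, x)" and x: "x \<in> L" by auto
    have "(0, p i x) \<in> derived_algebra (UNIV \<times> L) ext_br" if i: "i \<in> {1..r}" for i
    proof -
      have "ext_br (1, 0) (0, p i x) = real i *\<^sub>R (0, p i x)"
        using p_V_mem[OF i x] i by (intro ext.br_e) auto
      then have "(0, p i x) = inverse (real i) *\<^sub>R ext_br (1, 0) (0, p i x)" using i by simp
      also have "\<dots> \<in> derived_algebra (UNIV \<times> L) ext_br"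
        unfolding derived_algebra_def bracket_span_def
        using p_in_L x ext.e_in by (intro span_scale span_base) blast
      finally show ?thesis .
    qed
    then have "(\<Sum>i=1..r. (0, p i x)) \<in> derived_algebra (UNIV \<times> L) ext_br"
      unfolding derived_algebra_def bracket_span_def by (intro span_sum) auto
    moreover have "(\<Sum>i=1..r. (0, p i x)) = u"
      using p_sum[OF x] by (simp add: u prod_eq_iff fst_sum snd_sum)
    ultimately show "u \<in> derived_algebra (UNIV \<times> L) ext_br" by simp
  qed
qed

end

section \<open>Transport of the derived algebra, and projections from a grading\<close>

lemma derived_algebra_image:
  assumes "lie_algebra L br"
    and \<phi>: "linear_over L \<phi>" and \<psi>: "\<And>x. x \<in> L \<Longrightarrow> \<psi> (\<phi> x) = x"
  shows "derived_algebra (\<phi> ` L) (\<lambda>u v. \<phi> (br (\<psi> u) (\<psi> v))) = \<phi> ` derived_algebra L br"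
proof -
  interpret lie_algebra L br by fact
  let ?S = "{br x y | x y. x \<in> L \<and> y \<in> L}"
  have S: "?S \<subseteq> L" using closed by auto
  have "{\<phi> (br (\<psi> u) (\<psi> v)) | u v. u \<in> \<phi> ` L \<and> v \<in> \<phi> ` L} = \<phi> ` ?S"
    by (auto simp: \<psi> image_iff) (metis \<psi>)+
  then show ?thesis
    by (simp add: derived_algebra_def bracket_span_def linear_over_span_image[OF \<phi> subspace S])
qed

text \<open>Inverting the summation bijection gives the tuple of components of an element; its
  entries are the projections.\<close>

lemma positively_graded_projections:
  assumes "lie_algebra L br" "positively_graded L br"
  obtains V p r where "graded_lie_algebra L br V p r"
proof -
  interpret lie_algebra L br by fact
  obtain r :: nat and V where V: "\<forall>i\<in>{1..r}. subspace (V i)"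
    and triv: "\<forall>s>r. V s = {0}"
    and bij: "bij_betw (\<lambda>v. \<Sum>i\<in>{1..r}. v i) (\<Pi>\<^sub>E i\<in>{1..r}. V i) L"
    and brV: "\<forall>i\<in>{1..r}. \<forall>j\<in>{1..r}. \<forall>x\<in>V i. \<forall>y\<in>V j. br x y \<in> V (i + j)"
    using assms(2) unfolding positively_graded_def by (elim exE conjE) (rule that)
  let ?P = "\<Pi>\<^sub>E i\<in>{1..r}. V i" and ?T = "\<lambda>v. \<Sum>i\<in>{1..r}. v i"
  have img: "?T ` ?P = L" and inj: "inj_on ?T ?P"
    using bij by (simp_all add: bij_betw_def)
  define q where "q = inv_into ?P ?T"
  have q_mem: "q x \<in> ?P" if "x \<in> L" for x
    using that unfolding q_def img[symmetric] by (rule inv_into_into)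
  have q_sum: "?T (q x) = x" if "x \<in> L" for x
    using that unfolding q_def img[symmetric] by (rule f_inv_into_f)
  have q_eq: "q (?T v) = v" if "v \<in> ?P" for v
    using inj that unfolding q_def by (rule inv_into_f_f)
  have T_in: "?T v \<in> L" if "v \<in> ?P" for v
    using that unfolding img[symmetric] by (rule imageI)
  \<comment> \<open>Outside \<open>{1..r}\<close> the tuple \<open>q x\<close> is undefined; the
    value 0 makes \<open>p i\<close> linear for every index.\<close>
  define p where "p i x = (if i \<in> {1..r} then q x i else 0)" for i x
  \<comment> \<open>A homogeneous element is represented by the tuple with one possibly nonzero
    entry.\<close>
  have single: "(\<lambda>i\<in>{1..r}. if i = j then x else 0) \<in> ?P"
      "?T (\<lambda>i\<in>{1..r}. if i = j then x else 0) = x"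
    if "j \<in> {1..r}" "x \<in> V j" for j x
    using that V by (auto simp: subspace_0)
  have V_L: "V i \<subseteq> L" if i: "1 \<le> i" for i
  proof (cases "i \<le> r")
    case True
    then show ?thesis using single[of i] T_in i by (metis atLeastAtMost_iff subsetI)
  next
    case False
    then show ?thesis using triv subspace_0[OF subspace] by auto
  qed
  have p_mem: "p i x \<in> V i" if "i \<in> {1..r}" "x \<in> L" for i x
    using q_mem[OF that(2)] that(1) by (auto simp: p_def)
  have p_lin: "linear_over L (p i)" for i
  proof (rule linear_overI)
    fix x y a b assume xy: "x \<in> L" "y \<in> L"
    let ?v = "\<lambda>i\<in>{1..r}. a *\<^sub>R q x i + b *\<^sub>R q y i"
    have "?v \<in> ?P"
      using q_mem[OF xy(1)] q_mem[OF xy(2)] V by (auto intro!: subspace_add subspace_scale)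
    moreover have "?T ?v = a *\<^sub>R ?T (q x) + b *\<^sub>R ?T (q y)"
      by (simp add: sum.distrib scaleR_sum_right)
    \<comment> \<open>Uniqueness of the decomposition identifies the components of a linear
      combination.\<close>
    ultimately have "q (a *\<^sub>R x + b *\<^sub>R y) = ?v"
      using q_eq[of ?v] q_sum xy by simp
    then show "p i (a *\<^sub>R x + b *\<^sub>R y) = a *\<^sub>R p i x + b *\<^sub>R p i y" by (simp add: p_def)
  qed
  have p_0: "p i 0 = 0" for i using linear_over_0[OF p_lin subspace_0[OF subspace]] .
  have "graded_lie_algebra L br V p r"
  proof
    fix i j x
    show "p i x = (if i = j then x else 0)" if "1 \<le> j" "x \<in> V j"
    proof (cases "j \<le> r")
      case True
      then have "q x = (\<lambda>i\<in>{1..r}. if i = j then x else 0)"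
        using q_eq[OF single(1)[of j x]] single(2)[of j x] that by simp
      then show ?thesis using True that by (auto simp: p_def)
    next
      case False
      then show ?thesis using that triv p_0 by auto
    qed
    show "p i x \<in> L" if "x \<in> L"
      using p_mem[OF _ that, of i] V_L[of i] subspace_0[OF subspace] by (auto simp: p_def)
    show "(\<Sum>i=1..r. p i x) = x" if "x \<in> L"
      using q_sum[OF that] by (simp add: p_def)
    show "br x y \<in> V (i + j)" if "1 \<le> i" "1 \<le> j" "x \<in> V i" "y \<in> V j" for y
    proof (cases "i \<le> r \<and> j \<le> r")
      case True
      then show ?thesis using brV that by simp
    next
      case False
      \<comment> \<open>A weight above \<open>r\<close> forces one factor to be 0, and
        \<open>V (i + j)\<close> is then \<open>{0}\<close> as well.\<close>
      then have "x = 0 \<or> y = 0" using that triv by (metis linorder_not_less singletonD)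
      moreover have "x \<in> L" "y \<in> L" using V_L that by auto
      ultimately have "br x y = 0"
        using br_antisym[of x y] br_0_right[of x] br_0_right[of y] by auto
      then show ?thesis using False triv by auto
    qed
  qed (use V_L p_mem p_lin triv in auto)
  then show thesis by (rule that)
qed

section \<open>The extension realised in \<open>nat \<Rightarrow> real\<close>\<close>

theorem corollary4p4:
  fixes k :: "'a::real_vector set" and br :: "'a \<Rightarrow> 'a \<Rightarrow> 'a"
  assumes "nilpotent_lie_algebra k br" and "positively_graded k br"
  shows "\<exists>(g :: (nat \<Rightarrow> real) set) brg.
           lie_algebra g brg \<and> two_three_trivial g brg \<and>
           lie_isomorphic (derived_algebra g brg) brg k br"
proof -
  have "lie_algebra k br" using assms(1) by (simp add: nilpotent_lie_algebra_def)
  then obtain V p r where "graded_lie_algebra k br V p r"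
    using positively_graded_projections[OF _ assms(2)] by blast
  then interpret graded_lie_algebra k br V p r .
  let ?h = "(UNIV :: real set) \<times> k"
  interpret ext: weighted_lie_algebra ?h ext_br "(1, 0)" "\<lambda>i. Pair 0 ` V i"
    "\<lambda>i u. (0, p i (snd u))" r by (rule ext_weighted)
  obtain B where B: "finite B" "?h = span B" using ext.finite_dimensional by blast
  \<comment> \<open>The extension lives in \<open>real \<times> 'a\<close>; coordinates move it to
    the required ambient space.\<close>
  obtain \<phi> :: "real \<times> 'a \<Rightarrow> nat \<Rightarrow> real" where \<phi>: "linear_over ?h \<phi>" and inj: "inj_on \<phi> ?h"
    using finite_dimensional_embedding[OF B(2,1)] by blast
  define \<psi> where "\<psi> = inv_into ?h \<phi>"
  have \<psi>: "\<psi> (\<phi> u) = u" if "u \<in> ?h" for u using that inj by (simp add: \<psi>_def)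
  define brg where "brg u v = \<phi> (ext_br (\<psi> u) (\<psi> v))" for u v
  interpret img: weighted_lie_algebra "\<phi> ` ?h" brg "\<phi> (1, 0)" "\<lambda>i. \<phi> ` Pair 0 ` V i"
    "\<lambda>i u. \<phi> (0, p i (snd (\<psi> u)))" r
    unfolding brg_def by (rule ext.weighted_image[OF \<phi>]) (rule \<psi>)
  have derived: "derived_algebra (\<phi> ` ?h) brg = \<phi> ` ({0} \<times> k)"
    unfolding brg_def ext_derived_algebra[symmetric]
    by (rule derived_algebra_image[OF ext_lie_algebra \<phi>]) (rule \<psi>)
  have "lie_isomorphic (\<phi> ` ({0} \<times> k)) brg k br"
    unfolding lie_isomorphic_def
  proof (intro exI conjI)
    \<comment> \<open>The isomorphism undoes the coordinates and drops the real component, which is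
      0 on the derived algebra.\<close>
    show "bij_betw (snd \<circ> \<psi>) (\<phi> ` ({0} \<times> k)) k"
      by (rule bij_betwI[of _ _ _ "\<lambda>x. \<phi> (0, x)"]) (auto simp: \<psi>)
    show "\<forall>x\<in>\<phi> ` ({0} \<times> k). \<forall>y\<in>\<phi> ` ({0} \<times> k). (snd \<circ> \<psi>) (x + y) = (snd \<circ> \<psi>) x + (snd \<circ> \<psi>) y"
      using subspace_add[OF subspace]
      by (auto simp: \<psi> linear_over_add[OF \<phi>, symmetric])
    show "\<forall>c. \<forall>x\<in>\<phi> ` ({0} \<times> k). (snd \<circ> \<psi>) (c *\<^sub>R x) = c *\<^sub>R (snd \<circ> \<psi>) x"
      using subspace_scale[OF subspace]
      by (auto simp: \<psi> linear_over_scale[OF \<phi>, symmetric])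
    show "\<forall>x\<in>\<phi> ` ({0} \<times> k). \<forall>y\<in>\<phi> ` ({0} \<times> k).
        (snd \<circ> \<psi>) (brg x y) = br ((snd \<circ> \<psi>) x) ((snd \<circ> \<psi>) y)"
      by (auto simp: brg_def \<psi> ext_br_def closed)
  qed
  then have "lie_isomorphic (derived_algebra (\<phi> ` ?h) brg) brg k br" by (simp add: derived)
  with img.two_three_trivial img.lie_algebra_axioms show ?thesis by blast
qed

end
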